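(* Let $A$ be an abelian group and let $C=(c_1,\ldots,c_m)$ be a (finite) semiminimal family of $\operatorname{Dih}(A)$ containing at least one reflection. Write $c_i=(a_i,\varepsilon_i)$ with $a_i\in A$, $\varepsilon_i\in\{0,1\}$, and let $s$ be the first index such that $\varepsilon_s=1$. Define the family of elements of $A$ $$D:=(d_i)_{i\neq s},\qquad d_i:=a_i-\varepsilon_i a_s,$$ with the order inherited from $\{1,\dots,m\}$. If $r:=r(D)$ is the order of $D$, then $$\chi_c(\operatorname{Cay}(\operatorname{Dih}(A),C))\leq\begin{cases}2,&\text{if } r=\infty,\\[1mm] \dfrac{2r}{r-1},&\text{if } r\in\mathbb N.\end{cases}$$
   Context: For an abelian group $A$, the generalized dihedral group $\operatorname{Dih}(A)=A\rtimes C_2$ (the nontrivial element of the cyclic group $C_2$ of order 2 acting by inversion) consists of pairs $(a,\varepsilon)$, $a\in A$, $\varepsilon\in\{0,1\}$, with multiplication $(a,\varepsilon)(b,\delta)=(a+(-1)^\varepsilon b,\varepsilon+\delta)$, second coordinate modulo $2$. Elements of $A\times\{0\}$ are rotations; elements of $A\times\{1\}$ are reflections. A semiminimal family of a group $G$ is a well-ordered family $(c_\alpha)_{\alpha<\iota}$ of elements of $G$ (not necessarily generating $G$) such that $c_\alpha\notin\langle c_\beta:\beta<\alpha\rangle$ for every $\alpha<\iota$. For a well-ordered family $D=(d_\alpha)$ of elements of an abelian group $A$, put $H_\alpha:=\langle d_\beta:\beta<\alpha\rangle$ (with $\beta$ ranging over the index set of $D$). The relative order of $d_\alpha$ in $D$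 is $r_\alpha:=\operatorname{ord}_{A/H_\alpha}(d_\alpha+H_\alpha)\in\mathbb Z_{>0}\cup\{\infty\}$. The order of $D$ is $r(D):=\min_\alpha r_\alpha$, with $r(\varnothing):=\infty$. For a group $G$ and a family $C$ of elements of $G$, the undirected Cayley graph $\operatorname{Cay}(G,C)$ has vertex set $G$, with two distinct elements $a,b$ adjacent whenever $a^{-1}b\in C\cup C^{-1}$. $C$ is not required to generate $G$. The circular chromatic number $\chi_c(X)$ of a graph $X=(V,E)$ is the infimum of all real $s\ge 1$ for which there is a map $f:V\to\mathbb R/\mathbb Z$ such that for every edge $\{u,v\}$ the circular distance $\|f(u)-f(v)\|$ is at least $1/s$, where $\|x\|$ is the distance from $x\in\mathbb R/\mathbb Z$ to $0$ on the circle of circumference $1$. *)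

theory Defs
  imports "HOL-Algebra.Algebra" "HOL-Library.Extended_Nat" "HOL-Library.Extended_Real"
begin

text \<open>Abelian groups are written multiplicatively, as in HOL-Algebra; so \<open>(-1)\<^sup>\<epsilon> b\<close> becomes a
  power of \<open>b\<close> with exponent \<open>(-1)\<^sup>\<epsilon>\<close>.\<close>

definition Dih :: "('a, 'b) monoid_scheme \<Rightarrow> ('a \<times> nat) monoid" where
  "Dih A = \<lparr>carrier = carrier A \<times> {0, 1},
            monoid.mult = (\<lambda>(a, \<epsilon>) (b, \<delta>). (a \<otimes>\<^bsub>A\<^esub> b [^]\<^bsub>A\<^esub> ((-1 :: int) ^ \<epsilon>), (\<epsilon> + \<delta>) mod 2)),
            monoid.one = (\<one>\<^bsub>A\<^esub>, 0)\<rparr>"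

lemma group_Dih:
  assumes "comm_group A"
  shows "group (Dih A)"
proof -
  interpret comm_group A by fact
  show ?thesis
  proof (rule groupI)
    fix x assume "x \<in> carrier (Dih A)"
    then obtain a \<epsilon> where x: "x = (a, \<epsilon>)" "a \<in> carrier A" "\<epsilon> = 0 \<or> \<epsilon> = 1"
      by (auto simp: Dih_def)
    then have "(if \<epsilon> = 0 then inv\<^bsub>A\<^esub> a else a, \<epsilon>) \<in> carrier (Dih A)"
      and "(if \<epsilon> = 0 then inv\<^bsub>A\<^esub> a else a, \<epsilon>) \<otimes>\<^bsub>Dih A\<^esub> x = \<one>\<^bsub>Dih A\<^esub>"
      by (auto simp: Dih_def int_pow_neg)
    then show "\<exists>y\<in>carrier (Dih A). y \<otimes>\<^bsub>Dih A\<^esub> x = \<one>\<^bsub>Dih A\<^esub>"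
      by blast
  qed (auto simp: Dih_def int_pow_neg m_assoc inv_mult)
qed

text \<open>A well-ordered family is a function on a subset \<open>I\<close> of a well-ordered type,
  with the induced order on \<open>I\<close>.\<close>

definition semiminimal_family ::
    "('g, 'b) monoid_scheme \<Rightarrow> 'i::wellorder set \<Rightarrow> ('i \<Rightarrow> 'g) \<Rightarrow> bool" where
  "semiminimal_family G I c \<longleftrightarrow>
     c ` I \<subseteq> carrier G \<and> (\<forall>\<alpha>\<in>I. c \<alpha> \<notin> generate G (c ` {\<beta>\<in>I. \<beta> < \<alpha>}))"

text \<open>\<^const>\<open>group.ord\<close> is \<open>0\<close> on elements of infinite order.\<close>

definition relative_order ::
    "('a, 'b) monoid_scheme \<Rightarrow> 'i::wellorder set \<Rightarrow> ('i \<Rightarrow> 'a) \<Rightarrow> 'i \<Rightarrow> enat" where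
  "relative_order A I d \<alpha> =
     (let H = generate A (d ` {\<beta>\<in>I. \<beta> < \<alpha>});
          n = group.ord (A Mod H) (H #>\<^bsub>A\<^esub> d \<alpha>)
      in if n = 0 then \<infinity> else enat n)"

text \<open>The infimum in \<^typ>\<open>enat\<close> is attained for nonempty \<open>I\<close>, and it is \<open>\<infinity>\<close> for empty \<open>I\<close>.\<close>

definition family_order ::
    "('a, 'b) monoid_scheme \<Rightarrow> 'i::wellorder set \<Rightarrow> ('i \<Rightarrow> 'a) \<Rightarrow> enat" where
  "family_order A I d = (INF \<alpha>\<in>I. relative_order A I d \<alpha>)"

text \<open>A graph is a pair of a vertex set and a set of edges \<open>{u, v}\<close>.\<close>

type_synonym 'v graph = "'v set \<times> 'v set set"

definition Cay :: "('g, 'b) monoid_scheme \<Rightarrow> 'i set \<Rightarrow> ('i \<Rightarrow> 'g) \<Rightarrow> 'g graph" where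
  "Cay G I c =
     (carrier G,
      {{a, b} |a b. a \<in> carrier G \<and> b \<in> carrier G \<and> a \<noteq> b \<and>
         inv\<^bsub>G\<^esub> a \<otimes>\<^bsub>G\<^esub> b \<in> c ` I \<union> (\<lambda>x. inv\<^bsub>G\<^esub> x) ` c ` I})"

text \<open>Points of the circle \<open>\<real>/\<int>\<close> are given by real representatives; the distance of the class
  of \<open>x\<close> to \<open>0\<close> is the distance of \<open>x\<close> to the nearest integer.\<close>

definition circle_norm :: "real \<Rightarrow> real" where
  "circle_norm x = \<bar>x - of_int (round x)\<bar>"

text \<open>The infimum is taken in \<^typ>\<open>ereal\<close>, so that it is \<open>\<infinity>\<close> when no such map exists for any
  \<open>s\<close>.\<close>

definition circular_chromatic_number :: "'v graph \<Rightarrow> ereal" where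
  "circular_chromatic_number \<Gamma> =
     Inf {ereal s |s. s \<ge> 1 \<and>
       (\<exists>f :: 'v \<Rightarrow> real. \<forall>u\<in>fst \<Gamma>. \<forall>v\<in>fst \<Gamma>.
          {u, v} \<in> snd \<Gamma> \<longrightarrow> circle_norm (f u - f v) \<ge> 1 / s)}"

end

theory Submission
  imports Defs
begin

text \<open>Write \<open>A\<close> additively. Suppose that \<open>\<phi>\<close> is a homomorphism from \<open>A\<close> to the circle \<open>\<real>/\<int>\<close>. Colour a rotation
  \<open>(x, 0)\<close> by \<open>\<phi> x\<close> and a reflection \<open>(x, 1)\<close> by \<open>\<phi> (x - a\<^sub>s) + 1/2\<close>. Along an edge given by
  \<open>c\<^sub>i\<close> the colour changes, up to sign, by \<open>\<phi> (d\<^sub>i)\<close> if \<open>c\<^sub>i\<close> is a rotation and by \<open>\<phi> (d\<^sub>i) + 1/2\<close> if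
  it is a reflection; for \<open>c\<^sub>s\<close> it changes by exactly \<open>1/2\<close>. So the colouring is good when
  \<open>\<phi> (d\<^sub>i)\<close> is near the target \<open>1/2\<close> for rotations and near the target \<open>0\<close> for reflections:
  an error of at most \<open>1/(2r)\<close> leaves every edge with circular length at least
  \<open>1/2 - 1/(2r) = (r - 1)/(2r)\<close>, the reciprocal of the claimed bound
  (\<open>circular_chromatic_number_Cay_Dih_le\<close>).

  Such a \<open>\<phi>\<close> is built on the subgroup generated by \<open>D\<close>, one member of \<open>D\<close> at a time. When \<open>\<phi>\<close> is
  known on \<open>H\<^sub>i\<close>, the only constraint on the value at \<open>d\<^sub>i\<close> is that its \<open>r\<^sub>i\<close>-fold be
  \<open>\<phi> (r\<^sub>i d\<^sub>i)\<close>. The solutions are spaced by \<open>1/r\<^sub>i\<close> around the circle, so one of them is within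
  \<open>1/(2 r\<^sub>i) \<le> 1/(2r)\<close> of the target; for infinite \<open>r\<^sub>i\<close> there is no constraint and the target itself
  can be taken (\<open>compatible_value_near_target\<close>, \<open>circle_character_near_targets\<close>). The values
  on the rest of \<open>A\<close> are obtained by translating \<open>\<phi>\<close> to the other cosets.

  Semiminimality enters only through \<open>r \<ge> 2\<close>, without which the bound would not be a positive
  real number (\<open>two_le_relative_order_differences\<close>).\<close>

section \<open>Distances on the circle\<close>

lemma circle_norm_le_abs: "circle_norm x \<le> \<bar>x - of_int k\<bar>"
  unfolding circle_norm_def by (rule round_diff_minimal)

lemma circle_norm_cong:
  assumes "x - y \<in> \<int>"
  shows "circle_norm x = circle_norm y"
proof -
  have le: "circle_norm u \<le> circle_norm v" if "u - v \<in> \<int>" for u v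
  proof -
    obtain k where "u - v = of_int k"
      using \<open>u - v \<in> \<int>\<close> by (rule Ints_cases)
    then show ?thesis
      using circle_norm_le_abs[of u "round v + k"] by (simp add: circle_norm_def algebra_simps)
  qed
  have "y - x \<in> \<int>"
    using assms by (metis Ints_minus minus_diff_eq)
  with assms show ?thesis
    by (intro antisym le)
qed

lemma circle_norm_minus: "circle_norm (- x) = circle_norm x"
proof -
  have "circle_norm (- u) \<le> circle_norm u" for u
    using circle_norm_le_abs[of "- u" "- round u"] unfolding circle_norm_def of_int_minus by linarith
  from this[of x] this[of "- x"] show ?thesis by simp
qed

text \<open>The circle has diameter \<open>1/2\<close>, and \<open>y\<close> and \<open>y + 1/2\<close> are antipodal, so by the triangle
  inequality their distances to \<open>0\<close> add up to at least \<open>1/2\<close>.\<close>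

lemma circle_norm_antipodal_ge:
  assumes "x - (y + 1/2) \<in> \<int>"
  shows "1/2 - circle_norm y \<le> circle_norm x"
proof -
  have half: "1/2 \<le> \<bar>of_int n + (1/2 :: real)\<bar>" for n :: int
  proof -
    have "n \<ge> 0 \<or> n \<le> -1" by linarith
    then have "(of_int n :: real) \<ge> 0 \<or> (of_int n :: real) \<le> -1" by linarith
    then show ?thesis by linarith
  qed
  have "circle_norm x = circle_norm (y + 1/2)"
    using assms by (rule circle_norm_cong)
  moreover have "1/2 \<le> circle_norm (y + 1/2) + circle_norm y"
    using half[of "round y - round (y + 1/2)"] unfolding circle_norm_def of_int_diff by linarith
  ultimately show ?thesis by simp
qed

section \<open>Circle-valued characters of subgroups\<close>

text \<open>A homomorphism from \<open>H\<close> to \<open>\<real>/\<int>\<close>, given by real representatives of its values.\<close>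

definition circle_character :: "('a, 'b) monoid_scheme \<Rightarrow> 'a set \<Rightarrow> ('a \<Rightarrow> real) \<Rightarrow> bool" where
  "circle_character A H \<phi> \<longleftrightarrow> (\<forall>x\<in>H. \<forall>y\<in>H. \<phi> (x \<otimes>\<^bsub>A\<^esub> y) - (\<phi> x + \<phi> y) \<in> \<int>)"

context comm_group
begin

lemma circle_characterD:
  "circle_character G H \<phi> \<Longrightarrow> x \<in> H \<Longrightarrow> y \<in> H \<Longrightarrow> \<phi> (x \<otimes> y) - (\<phi> x + \<phi> y) \<in> \<int>"
  unfolding circle_character_def by blast

lemma circle_character_one:
  assumes "subgroup H G" "circle_character G H \<phi>"
  shows "\<phi> \<one> \<in> \<int>"
proof -
  have "\<phi> (\<one> \<otimes> \<one>) - (\<phi> \<one> + \<phi> \<one>) \<in> \<int>"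
    using assms by (intro circle_characterD subgroup.one_closed)
  then have "- \<phi> \<one> \<in> \<int>" by simp
  then show ?thesis by (metis Ints_minus minus_minus)
qed

lemma circle_character_int_pow:
  assumes H: "subgroup H G" and \<phi>: "circle_character G H \<phi>" and x: "x \<in> H"
  shows "\<phi> (x [^] k) - of_int k * \<phi> x \<in> \<int>" (is "?P k")
proof -
  have xc: "x \<in> carrier G"
    using H x by (rule subgroup.mem_carrier)
  have powH: "x [^] j \<in> H" for j :: int
    using H x by (metis subgroup_int_pow_closed)
  have step: "?P (j + 1) \<longleftrightarrow> ?P j" for j
  proof -
    have "x [^] (j + 1) = x [^] j \<otimes> x"
      using int_pow_mult[OF xc, of j 1] xc by simp
    then have "\<phi> (x [^] (j + 1)) - (\<phi> (x [^] j) + \<phi> x) \<in> \<int>"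
      using circle_characterD[OF \<phi> powH[of j] x] by simp
    then have "\<phi> (x [^] (j + 1)) - of_int (j + 1) * \<phi> x - (\<phi> (x [^] j) - of_int j * \<phi> x) \<in> \<int>"
      by (simp add: algebra_simps)
    then show ?thesis
      by (metis Ints_add Ints_diff diff_add_cancel diff_diff_eq2 add_diff_cancel_left')
  qed
  show ?thesis
  proof (induction k rule: int_induct[where k = 0])
    case base
    then show ?case using circle_character_one[OF H \<phi>] by simp
  next
    case (step1 i)
    then show ?case using step[of i] by simp
  next
    case (step2 i)
    then show ?case using step[of "i - 1"] by simp
  qed
qed

text \<open>With \<open>n\<close> the order of \<open>d\<close> modulo \<open>H\<close>, this reduces the conditions \<open>k \<theta> = \<phi> (d\<^sup>k)\<close>,
  \<open>d\<^sup>k \<in> H\<close>, on the value \<open>\<theta>\<close> at \<open>d\<close> of an extension of \<open>\<phi>\<close> to the single one for \<open>k = n\<close>.\<close>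

lemma int_pow_mem_iff_relative_order_dvd:
  assumes H: "subgroup H G" and d: "d \<in> carrier G"
  shows "d [^] k \<in> H \<longleftrightarrow> int (group.ord (G Mod H) (H #> d)) dvd k"
proof -
  interpret N: normal H G
    using H by (rule subgroup_imp_normal)
  interpret Q: group "G Mod H"
    by (rule N.factorgroup_is_group)
  have "d [^] k \<in> H \<longleftrightarrow> H #> (d [^] k) = H"
    using H d coset_join1 coset_join2 subgroup.subset by (metis int_pow_closed)
  also have "H #> (d [^] k) = (H #> d) [^]\<^bsub>G Mod H\<^esub> k"
    using N.r_coset_hom_Mod d by (rule hom_int_pow) (rule is_group Q.is_group)+
  also have "\<dots> = H \<longleftrightarrow> int (Q.ord (H #> d)) dvd k"
    using Q.int_pow_eq_id[of "H #> d" k] d H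
    by (simp add: FactGroup_def subgroup.subset rcosetsI)
  finally show ?thesis .
qed

text \<open>The real solutions \<open>\<theta>\<close> of \<open>n \<theta> = \<phi> (d\<^sup>n)\<close> modulo \<open>1\<close> are spaced by \<open>1/n\<close>, so one of
  them lies within \<open>1/(2n)\<close> of any target \<open>t\<close>. For \<open>n = 0\<close>, no nontrivial power of \<open>d\<close>
  is in \<open>H\<close>, nothing constrains \<open>\<theta>\<close>, and \<open>1/0 = 0\<close> makes the bound say \<open>\<theta> = t\<close>.\<close>

lemma compatible_value_near_target:
  assumes H: "subgroup H G" and d: "d \<in> carrier G" and \<phi>: "circle_character G H \<phi>"
  defines "n \<equiv> group.ord (G Mod H) (H #> d)"
  shows "\<exists>\<theta>. (\<forall>k::int. d [^] k \<in> H \<longrightarrow> \<phi> (d [^] k) - of_int k * \<theta> \<in> \<int>)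
    \<and> \<bar>\<theta> - t\<bar> \<le> 1 / (2 * real n)"
proof (cases "n = 0")
  case True
  have "\<phi> (d [^] k) - of_int k * t \<in> \<int>" if "d [^] k \<in> H" for k :: int
  proof -
    have "k = 0"
      using that True int_pow_mem_iff_relative_order_dvd[OF H d] by (simp add: n_def)
    then show ?thesis
      using circle_character_one[OF H \<phi>] by simp
  qed
  with True show ?thesis by (intro exI[of _ t]) simp
next
  case False
  \<comment> \<open>Every integer summand makes \<open>n \<theta>\<close> agree with \<open>\<phi> (d\<^sup>n)\<close> modulo \<open>1\<close>; the rounded one brings
    \<open>n \<theta>\<close> within \<open>1/2\<close> of \<open>n t\<close>.\<close>
  define y where "y = d [^] int n"
  define z where "z = real n * t - \<phi> y"
  define \<theta> where "\<theta> = (\<phi> y + of_int (round z)) / real n"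
  have yH: "y \<in> H"
    unfolding y_def int_pow_mem_iff_relative_order_dvd[OF H d] by (simp add: n_def)
  have n\<theta>: "real n * \<theta> = \<phi> y + of_int (round z)"
    using False by (simp add: \<theta>_def)
  have "\<phi> (d [^] k) - of_int k * \<theta> \<in> \<int>" if "d [^] k \<in> H" for k :: int
  proof -
    obtain q where q: "k = int n * q"
      using \<open>d [^] k \<in> H\<close> int_pow_mem_iff_relative_order_dvd[OF H d]
      by (auto simp: n_def elim: dvdE)
    have "\<phi> (d [^] k) - of_int k * \<theta> = (\<phi> (y [^] q) - of_int q * \<phi> y) - of_int (q * round z)"
    proof -
      have "of_int k * \<theta> = of_int q * (real n * \<theta>)"
        by (simp add: q)
      also have "\<dots> = of_int q * \<phi> y + of_int (q * round z)"
        unfolding n\<theta> by (simp add: algebra_simps)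
      finally show ?thesis
        using d by (simp add: q y_def int_pow_pow)
    qed
    then show ?thesis
      using circle_character_int_pow[OF H \<phi> yH, of q] by (metis Ints_diff Ints_of_int)
  qed
  moreover have "\<bar>\<theta> - t\<bar> \<le> 1 / (2 * real n)"
  proof -
    have "real n * (\<theta> - t) = of_int (round z) - z"
      using n\<theta> by (simp add: z_def algebra_simps)
    then have "real n * \<bar>\<theta> - t\<bar> \<le> 1/2"
      using of_int_round_abs_le[of z] by (metis abs_mult abs_of_nat)
    then show ?thesis
      using False by (simp add: field_simps)
  qed
  ultimately show ?thesis
    by blast
qed

lemma generate_insert_decompose:
  assumes S: "S \<subseteq> carrier G" and d: "d \<in> carrier G" and x: "x \<in> generate G (insert d S)"
  shows "\<exists>h\<in>generate G S. \<exists>k::int. x = h \<otimes> d [^] k"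
proof -
  have H: "subgroup (generate G S) G"
    using S by (rule generate_is_subgroup)
  note Hc = subgroup.mem_carrier[OF H]
  show ?thesis
    using x
  proof (induction rule: generate.induct)
    case one
    have "\<one> = \<one> \<otimes> d [^] (0::int)" by simp
    then show ?case using generate.one by metis
  next
    case (incl x)
    show ?case
    proof (cases "x = d")
      case True
      then have "x = \<one> \<otimes> d [^] (1::int)" using d by simp
      then show ?thesis using generate.one by metis
    next
      case False
      then have "x \<in> generate G S" using incl by (auto intro: generate.incl)
      moreover have "x = x \<otimes> d [^] (0::int)" using calculation Hc by simp
      ultimately show ?thesis by metis
    qed
  next
    case (inv x)
    show ?case
    proof (cases "x = d")
      case True
      then have "inv x = \<one> \<otimes> d [^] (-1::int)" using d by (simp add: int_pow_neg)
      then show ?thesis using generate.one by metis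
    next
      case False
      then have "inv x \<in> generate G S" using inv by (auto intro: generate.inv)
      moreover have "inv x = inv x \<otimes> d [^] (0::int)" using calculation Hc by simp
      ultimately show ?thesis by metis
    qed
  next
    case (eng x y)
    then obtain h k h' k' where *: "h \<in> generate G S" "x = h \<otimes> d [^] (k::int)"
      "h' \<in> generate G S" "y = h' \<otimes> d [^] (k'::int)" by blast
    then have "x \<otimes> y = (h \<otimes> h') \<otimes> d [^] (k + k')"
      using d Hc by (simp add: int_pow_mult m_ac)
    moreover have "h \<otimes> h' \<in> generate G S" using * generate.eng by metis
    ultimately show ?case by blast
  qed
qed

text \<open>The extension sends \<open>h d\<^sup>k\<close> to \<open>\<phi> h + k \<theta>\<close>. The compatibility of \<open>\<theta>\<close> with \<open>\<phi>\<close> is exactly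
  what makes this independent, modulo \<open>1\<close>, of the chosen decomposition.\<close>

lemma circle_character_extend:
  assumes S: "S \<subseteq> carrier G" and d: "d \<in> carrier G"
    and \<phi>: "circle_character G (generate G S) \<phi>"
    and \<theta>: "\<And>k::int. d [^] k \<in> generate G S \<Longrightarrow> \<phi> (d [^] k) - of_int k * \<theta> \<in> \<int>"
  shows "\<exists>\<psi>. circle_character G (generate G (insert d S)) \<psi>
    \<and> (\<forall>h\<in>generate G S. \<psi> h - \<phi> h \<in> \<int>) \<and> \<psi> d - \<theta> \<in> \<int>"
proof -
  define H where "H = generate G S"
  have H: "subgroup H G"
    unfolding H_def using S by (rule generate_is_subgroup)
  note Hc = subgroup.mem_carrier[OF H]
  have well_defined: "(\<phi> h + of_int k * \<theta>) - (\<phi> h' + of_int k' * \<theta>) \<in> \<int>"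
    if hH: "h \<in> H" and h'H: "h' \<in> H" and eq: "h \<otimes> d [^] k = h' \<otimes> d [^] k'"
    for h h' and k k' :: int
  proof -
    have "h' \<otimes> d [^] (k' - k) = (h' \<otimes> d [^] k') \<otimes> inv (d [^] k)"
      using Hc[OF h'H] d by (simp add: int_pow_diff m_assoc)
    also have "\<dots> = (h \<otimes> d [^] k) \<otimes> inv (d [^] k)"
      by (simp only: eq)
    also have "\<dots> = h"
      using Hc[OF hH] d by (simp add: m_assoc)
    finally have h: "h = h' \<otimes> d [^] (k' - k)" by simp
    then have dk: "d [^] (k' - k) = inv h' \<otimes> h"
      using Hc[OF h'H] d by (simp flip: m_assoc)
    have "d [^] (k' - k) \<in> H"
      unfolding dk by (intro subgroup.m_closed[OF H] subgroup.m_inv_closed[OF H] hH h'H)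
    then have "\<phi> h - (\<phi> h' + \<phi> (d [^] (k' - k))) \<in> \<int>"
      unfolding H_def by (subst h) (use circle_characterD[OF \<phi>] h'H in \<open>simp add: H_def\<close>)
    moreover have "\<phi> (d [^] (k' - k)) - of_int (k' - k) * \<theta> \<in> \<int>"
      using \<open>d [^] (k' - k) \<in> H\<close> unfolding H_def by (rule \<theta>)
    ultimately have "\<phi> h - (\<phi> h' + \<phi> (d [^] (k' - k)))
        + (\<phi> (d [^] (k' - k)) - of_int (k' - k) * \<theta>) \<in> \<int>"
      by (rule Ints_add)
    then show ?thesis
      by (simp add: algebra_simps)
  qed
  define \<psi> where "\<psi> x = (SOME v. \<exists>h\<in>H. \<exists>k::int. x = h \<otimes> d [^] k \<and> v = \<phi> h + of_int k * \<theta>)" for x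
  have \<psi>: "\<psi> (h \<otimes> d [^] k) - (\<phi> h + of_int k * \<theta>) \<in> \<int>" if "h \<in> H" for h and k :: int
  proof -
    have "\<exists>v. \<exists>h'\<in>H. \<exists>k'::int. h \<otimes> d [^] k = h' \<otimes> d [^] k' \<and> v = \<phi> h' + of_int k' * \<theta>"
      using that by blast
    from someI_ex[OF this] obtain h' and k' :: int
      where "h' \<in> H" "h \<otimes> d [^] k = h' \<otimes> d [^] k'" "\<psi> (h \<otimes> d [^] k) = \<phi> h' + of_int k' * \<theta>"
      unfolding \<psi>_def by blast
    with that show ?thesis
      using well_defined[of h' h k' k] by simp
  qed
  have "circle_character G (generate G (insert d S)) \<psi>"
    unfolding circle_character_def
  proof (intro ballI)
    fix x y
    assume "x \<in> generate G (insert d S)" "y \<in> generate G (insert d S)"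
    then obtain h k h' k' where hk: "h \<in> H" "x = h \<otimes> d [^] (k::int)"
      "h' \<in> H" "y = h' \<otimes> d [^] (k'::int)"
      using generate_insert_decompose[OF S d] unfolding H_def by metis
    then have xy: "x \<otimes> y = (h \<otimes> h') \<otimes> d [^] (k + k')"
      using d Hc by (simp add: int_pow_mult m_ac)
    have "\<psi> (x \<otimes> y) - (\<phi> (h \<otimes> h') + of_int (k + k') * \<theta>) \<in> \<int>"
      unfolding xy using hk by (intro \<psi> subgroup.m_closed[OF H])
    moreover have "\<phi> (h \<otimes> h') - (\<phi> h + \<phi> h') \<in> \<int>"
      using \<phi> hk unfolding H_def by (intro circle_characterD)
    moreover have "\<psi> x - (\<phi> h + of_int k * \<theta>) \<in> \<int>" "\<psi> y - (\<phi> h' + of_int k' * \<theta>) \<in> \<int>"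
      using hk \<psi> by auto
    ultimately have "(\<psi> (x \<otimes> y) - (\<phi> (h \<otimes> h') + of_int (k + k') * \<theta>))
        + (\<phi> (h \<otimes> h') - (\<phi> h + \<phi> h'))
        - (\<psi> x - (\<phi> h + of_int k * \<theta>)) - (\<psi> y - (\<phi> h' + of_int k' * \<theta>)) \<in> \<int>"
      by (rule Ints_diff[OF Ints_diff[OF Ints_add]])
    then show "\<psi> (x \<otimes> y) - (\<psi> x + \<psi> y) \<in> \<int>"
      by (simp add: algebra_simps)
  qed
  moreover have "\<psi> h - \<phi> h \<in> \<int>" if "h \<in> generate G S" for h
    using \<psi>[of h 0] that Hc by (simp add: H_def)
  moreover have "\<psi> d - \<theta> \<in> \<int>"
  proof -
    have "\<psi> d - (\<phi> \<one> + \<theta>) \<in> \<int>"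
      using \<psi>[OF subgroup.one_closed[OF H], of 1] d by simp
    from Ints_add[OF this circle_character_one[OF H \<phi>[folded H_def]]] show ?thesis
      by simp
  qed
  ultimately show ?thesis by blast
qed

text \<open>The values at the members of \<open>d\<close> can be chosen one after the other, each one near its
  target. The bound is stated for all \<open>n\<close> up to the relative order so that it also covers
  infinite relative order, where it forces the distance to be \<open>0\<close>.\<close>

lemma circle_character_near_targets:
  fixes I :: "'i::wellorder set" and d :: "'i \<Rightarrow> 'a" and t :: "'i \<Rightarrow> real"
  assumes "finite I" and "d ` I \<subseteq> carrier G"
  shows "\<exists>\<phi>. circle_character G (generate G (d ` I)) \<phi> \<and>
    (\<forall>i\<in>I. \<forall>n>0. enat n \<le> relative_order G I d i \<longrightarrow>
       circle_norm (\<phi> (d i) - t i) \<le> 1 / (2 * real n))"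
  using assms
proof (induction rule: finite_linorder_max_induct)
  case empty
  then show ?case by (intro exI[of _ "\<lambda>_. 0"]) (simp add: circle_character_def)
next
  case (insert b J)
  have S: "d ` J \<subseteq> carrier G" and b: "d b \<in> carrier G"
    using insert.prems by auto
  define H where "H = generate G (d ` J)"
  have H: "subgroup H G"
    unfolding H_def using S by (rule generate_is_subgroup)
  have before_b: "{j \<in> insert b J. j < b} = J"
    using insert.hyps by auto
  have before: "{j \<in> insert b J. j < i} = {j \<in> J. j < i}" if "i \<in> J" for i
  proof -
    have "\<not> b < i" using insert.hyps(2) that by (meson less_asym)
    then show ?thesis by blast
  qed
  from insert.IH[OF S] obtain \<phi> where \<phi>: "circle_character G H \<phi>"
    and near: "\<And>i n. i \<in> J \<Longrightarrow> n > 0 \<Longrightarrow> enat n \<le> relative_order G J d i \<Longrightarrow>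
         circle_norm (\<phi> (d i) - t i) \<le> 1 / (2 * real n)"
    unfolding H_def by blast
  define q where "q = group.ord (G Mod H) (H #> d b)"
  obtain \<theta> where \<theta>: "\<And>k::int. d b [^] k \<in> H \<Longrightarrow> \<phi> (d b [^] k) - of_int k * \<theta> \<in> \<int>"
    and \<theta>q: "\<bar>\<theta> - t b\<bar> \<le> 1 / (2 * real q)"
    using compatible_value_near_target[OF H b \<phi>, of "t b"] unfolding q_def by blast
  obtain \<psi> where \<psi>: "circle_character G (generate G (insert (d b) (d ` J))) \<psi>"
    and ext: "\<And>h. h \<in> H \<Longrightarrow> \<psi> h - \<phi> h \<in> \<int>" and \<psi>b: "\<psi> (d b) - \<theta> \<in> \<int>"
    using circle_character_extend[OF S b \<phi>[unfolded H_def] \<theta>[unfolded H_def]]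
    unfolding H_def by blast
  have "circle_norm (\<psi> (d i) - t i) \<le> 1 / (2 * real n)"
    if "i \<in> insert b J" "n > 0" and n: "enat n \<le> relative_order G (insert b J) d i" for i n
  proof (cases "i = b")
    case True
    have "circle_norm (\<psi> (d b) - t b) = circle_norm (\<theta> - t b)"
      using \<psi>b by (intro circle_norm_cong) simp
    also have "\<dots> \<le> \<bar>\<theta> - t b\<bar>"
      using circle_norm_le_abs[of "\<theta> - t b" 0] by simp
    also have "\<dots> \<le> 1 / (2 * real n)"
    proof (cases "q = 0")
      case True
      then show ?thesis using \<theta>q by simp
    next
      case False
      then have "n \<le> q"
        using n unfolding \<open>i = b\<close> relative_order_def before_b
        by (simp add: q_def H_def Let_def)
      then have "1 / (2 * real q) \<le> 1 / (2 * real n)"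
        using \<open>n > 0\<close> by (simp add: frac_le)
      then show ?thesis using \<theta>q by linarith
    qed
    finally show ?thesis by (simp add: True)
  next
    case False
    then have i: "i \<in> J" using that by simp
    have "\<psi> (d i) - \<phi> (d i) \<in> \<int>"
      using i unfolding H_def by (intro ext[unfolded H_def] generate.incl) simp
    then have "circle_norm (\<psi> (d i) - t i) = circle_norm (\<phi> (d i) - t i)"
      by (intro circle_norm_cong) simp
    moreover have "relative_order G (insert b J) d i = relative_order G J d i"
      by (simp only: relative_order_def before[OF i])
    ultimately show ?thesis
      using near[OF i \<open>n > 0\<close>] n by simp
  qed
  with \<psi> show ?case by auto
qed

text \<open>Only translations by elements of \<open>H\<close> matter for the colouring, so instead of extending
  \<open>\<phi>\<close> to a character of the whole group it is enough to copy it to every coset of \<open>H\<close>,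
  based at an arbitrary representative.\<close>

lemma circle_character_spread_over_cosets:
  assumes H: "subgroup H G" and \<phi>: "circle_character G H \<phi>"
  shows "\<exists>\<Phi>. \<forall>h\<in>H. \<forall>x\<in>carrier G. \<Phi> (h \<otimes> x) - (\<phi> h + \<Phi> x) \<in> \<int>"
proof (intro exI ballI)
  define rep where "rep x = (SOME y. y \<in> H #> x)" for x
  define \<Phi> where "\<Phi> x = \<phi> (x \<otimes> inv (rep x))" for x
  fix h x
  assume h: "h \<in> H" and x: "x \<in> carrier G"
  have hc: "h \<in> carrier G"
    using H h by (rule subgroup.mem_carrier)
  have "rep x \<in> H #> x"
    unfolding rep_def using rcos_self[OF x H] by (rule someI)
  then obtain g where g: "g \<in> H" "rep x = g \<otimes> x"
    unfolding r_coset_def by blast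
  then have gc: "g \<in> carrier G"
    using H by (metis subgroup.mem_carrier)
  have "x \<otimes> inv (rep x) = inv g"
    using gc x inv_solve_right[of "inv g" x "rep x"] by (simp add: g flip: m_assoc)
  then have base: "x \<otimes> inv (rep x) \<in> H"
    using subgroup.m_inv_closed[OF H g(1)] by simp
  have "H #> (h \<otimes> x) = H #> x"
    using coset_mult_assoc[OF subgroup.subset[OF H] hc x] coset_join2[OF hc H h] by simp
  then have "rep (h \<otimes> x) = rep x"
    by (simp add: rep_def)
  moreover have "rep x \<in> carrier G"
    using g gc x by simp
  ultimately have "\<Phi> (h \<otimes> x) = \<phi> (h \<otimes> (x \<otimes> inv (rep x)))"
    using hc x by (simp add: \<Phi>_def m_assoc)
  then show "\<Phi> (h \<otimes> x) - (\<phi> h + \<Phi> x) \<in> \<int>"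
    using circle_characterD[OF \<phi> h base] by (simp add: \<Phi>_def)
qed

end

section \<open>Semiminimal families of generalized dihedral groups\<close>

lemma carrier_Dih: "carrier (Dih A) = carrier A \<times> {0, 1}"
  by (simp add: Dih_def)

lemma one_Dih: "\<one>\<^bsub>Dih A\<^esub> = (\<one>\<^bsub>A\<^esub>, 0)"
  by (simp add: Dih_def)

context comm_group
begin

lemma Dih_mult_rotation:
  "y \<in> carrier G \<Longrightarrow> \<epsilon> \<in> {0, 1} \<Longrightarrow> (x, 0) \<otimes>\<^bsub>Dih G\<^esub> (y, \<epsilon>) = (x \<otimes> y, \<epsilon>)"
  by (auto simp: Dih_def)

lemma Dih_mult_reflection:
  "y \<in> carrier G \<Longrightarrow> \<epsilon> \<in> {0, 1} \<Longrightarrow> (x, 1) \<otimes>\<^bsub>Dih G\<^esub> (y, \<epsilon>) = (x \<otimes> inv y, 1 - \<epsilon>)"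
  by (auto simp: Dih_def int_pow_neg)

lemma generate_rotations:
  assumes T: "T \<subseteq> carrier (Dih G)" and S: "S \<subseteq> carrier G"
    and ST: "\<And>x. x \<in> S \<Longrightarrow> (x, 0) \<in> generate (Dih G) T" and x: "x \<in> generate G S"
  shows "(x, 0) \<in> generate (Dih G) T"
proof -
  interpret D: group "Dih G"
    using comm_group_axioms by (rule group_Dih)
  have gc: "y \<in> carrier G" if "y \<in> generate G S" for y
    using generate_in_carrier[OF S that] .
  show ?thesis
    using x
  proof (induction rule: generate.induct)
    case one
    show ?case using generate.one[of "Dih G" T] by (simp add: one_Dih)
  next
    case (incl h)
    then show ?case by (rule ST)
  next
    case (inv h)
    then have h: "h \<in> carrier G" using S by auto
    then have "inv\<^bsub>Dih G\<^esub> (h, 0) = (inv h, 0)"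
      by (intro D.inv_equality) (auto simp: Dih_mult_rotation carrier_Dih one_Dih)
    then show ?case
      using D.generate_m_inv_closed[OF T ST[OF inv]] by simp
  next
    case (eng h h')
    then have "(h, 0) \<otimes>\<^bsub>Dih G\<^esub> (h', 0) = (h \<otimes> h', 0)"
      using gc by (simp add: Dih_mult_rotation)
    then show ?case
      using generate.eng[OF eng.IH] by simp
  qed
qed

text \<open>Multiplying by the first reflection \<open>c s\<close> turns every reflection \<open>c j\<close> into the rotation by
  \<open>d j\<close>. Hence a relation among the \<open>d j\<close> is one among the \<open>c j\<close>, so \<open>d i\<close>
  is not in the subgroup generated by its predecessors, which is to say that its order
  modulo that subgroup is not \<open>1\<close>.\<close>

lemma two_le_relative_order_differences:
  fixes I :: "'i::wellorder set"
  assumes semi: "semiminimal_family (Dih G) I c"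
    and c: "\<And>i. i \<in> I \<Longrightarrow> c i = (a i, \<epsilon> i)"
    and s: "s \<in> I" "\<epsilon> s = 1" and first: "\<And>i. i \<in> I \<Longrightarrow> \<epsilon> i = 1 \<Longrightarrow> s \<le> i"
    and d: "\<And>i. i \<in> I - {s} \<Longrightarrow> d i = a i \<otimes> inv (a s [^] \<epsilon> i)"
    and i: "i \<in> I - {s}"
  shows "2 \<le> relative_order G (I - {s}) d i"
proof -
  have ac: "a j \<in> carrier G" and \<epsilon>: "\<epsilon> j \<in> {0, 1}" if "j \<in> I" for j
    using semi c[OF that] that unfolding semiminimal_family_def carrier_Dih by force+
  have dc: "d j \<in> carrier G" if "j \<in> I - {s}" for j
    using d[OF that] ac s that by simp
  define T where "T = c ` {j \<in> I. j < i}"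
  define S where "S = d ` {j \<in> I - {s}. j < i}"
  have T: "T \<subseteq> carrier (Dih G)"
    using semi unfolding semiminimal_family_def T_def by blast
  have S: "S \<subseteq> carrier G"
    using dc unfolding S_def by blast
  have sT: "(a s, 1) \<in> generate (Dih G) T" if "j \<in> I - {s}" "j \<le> i" "\<epsilon> j = 1" for j
  proof -
    have "s < i" using first[of j] that by auto
    then show ?thesis
      using s c[OF s(1)] unfolding T_def by (intro generate.incl image_eqI[of _ _ s]) auto
  qed
  have "(x, 0) \<in> generate (Dih G) T" if x: "x \<in> S" for x
  proof -
    obtain j where j: "j \<in> I - {s}" "j < i" "x = d j"
      using x unfolding S_def by blast
    have cj: "(a j, \<epsilon> j) \<in> generate (Dih G) T"
      using j c[of j] unfolding T_def by (intro generate.incl) force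
    show ?thesis
    proof (cases "\<epsilon> j = 0")
      case True
      then show ?thesis using cj j d[of j] ac[of j] by simp
    next
      case False
      then have 1: "\<epsilon> j = 1" using \<epsilon>[of j] j by simp
      then have "(a j, \<epsilon> j) \<otimes>\<^bsub>Dih G\<^esub> (a s, 1) = (x, 0)"
        using ac s j d[of j] by (simp add: Dih_mult_reflection[unfolded One_nat_def])
      then show ?thesis
        using generate.eng[OF cj sT[OF j(1) _ 1]] j by simp
    qed
  qed
  then have rot: "(x, 0) \<in> generate (Dih G) T" if "x \<in> generate G S" for x
    using generate_rotations[OF T S] that by blast
  have "d i \<notin> generate G S"
  proof
    assume "d i \<in> generate G S"
    then have di: "(d i, 0) \<in> generate (Dih G) T" by (rule rot)
    have "c i \<in> generate (Dih G) T"
    proof (cases "\<epsilon> i = 0")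
      case True
      then show ?thesis using di i d[of i] c[of i] ac[of i] by simp
    next
      case False
      then have 1: "\<epsilon> i = 1" using \<epsilon>[of i] i by simp
      then have "(d i, 0) \<otimes>\<^bsub>Dih G\<^esub> (a s, 1) = c i"
        using ac s i d[of i] c[of i] by (simp add: Dih_mult_rotation m_assoc)
      then show ?thesis
        using generate.eng[OF di sT[OF i _ 1]] by simp
    qed
    then show False
      using semi i unfolding semiminimal_family_def T_def by blast
  qed
  then have "group.ord (G Mod generate G S) (generate G S #> d i) \<noteq> 1"
    using int_pow_mem_iff_relative_order_dvd[OF generate_is_subgroup[OF S] dc[OF i], of 1] dc[OF i]
    by auto
  then show ?thesis
    unfolding relative_order_def S_def[symmetric] Let_def
    by (simp add: numeral_eq_enat)
qed

end

section \<open>Circular colourings of Cayley graphs\<close>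

lemma (in group) circular_chromatic_number_Cay_le:
  assumes c: "c ` I \<subseteq> carrier G" and s: "1 \<le> s"
    and f: "\<And>u i. u \<in> carrier G \<Longrightarrow> i \<in> I \<Longrightarrow> 1 / s \<le> circle_norm (f u - f (u \<otimes> c i))"
  shows "circular_chromatic_number (Cay G I c) \<le> ereal s"
proof -
  have edge: "1 / s \<le> circle_norm (f u - f v) \<and> 1 / s \<le> circle_norm (f v - f u)"
    if u: "u \<in> carrier G" and v: "v \<in> carrier G"
      and uv: "inv u \<otimes> v \<in> c ` I \<union> (\<lambda>x. inv x) ` c ` I" for u v
  proof -
    have "\<exists>i\<in>I. v = u \<otimes> c i \<or> u = v \<otimes> c i"
    proof (cases "inv u \<otimes> v \<in> c ` I")
      case True
      then obtain i where "i \<in> I" "c i = inv u \<otimes> v" by auto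
      then show ?thesis using u v by (metis inv_closed m_assoc r_inv l_one)
    next
      case False
      then obtain i where i: "i \<in> I" "inv u \<otimes> v = inv (c i)" using uv by auto
      then have "inv v \<otimes> u = c i"
        using u v c by (metis image_subset_iff inv_closed inv_inv inv_mult_group)
      then show ?thesis using i u v by (metis inv_closed m_assoc r_inv l_one)
    qed
    then have "1 / s \<le> circle_norm (f u - f v) \<or> 1 / s \<le> circle_norm (f v - f u)"
      using f u v by blast
    then show ?thesis
      using circle_norm_minus[of "f u - f v"] by simp
  qed
  have "\<forall>u\<in>fst (Cay G I c). \<forall>v\<in>fst (Cay G I c).
      {u, v} \<in> snd (Cay G I c) \<longrightarrow> 1 / s \<le> circle_norm (f u - f v)"
    using edge unfolding Cay_def by (auto simp: doubleton_eq_iff)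
  then show ?thesis
    using s unfolding circular_chromatic_number_def by (intro Inf_lower) blast
qed

text \<open>The rotations are coloured by \<open>\<Phi>\<close>, and the reflections by \<open>\<Phi>\<close> recentred at the reflection
  \<open>c s\<close> and then turned by half the circle. Crossing an edge given by \<open>c i\<close> then changes the colour
  by \<open>\<phi> (d i)\<close>, up to sign, plus \<open>1/2\<close> if \<open>c i\<close> is a reflection; measured from the target value
  of \<open>\<phi> (d i)\<close> this is a change by \<open>1/2\<close> up to the error of \<open>\<phi> (d i)\<close>.\<close>

lemma circular_chromatic_number_Cay_Dih_le:
  fixes a d :: "'i \<Rightarrow> 'a" and \<epsilon> :: "'i \<Rightarrow> nat"
  assumes "comm_group A"
    and cc: "c ` I \<subseteq> carrier (Dih A)"
    and c: "\<And>i. i \<in> I \<Longrightarrow> c i = (a i, \<epsilon> i)"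
    and s: "s \<in> I" "\<epsilon> s = 1"
    and d: "\<And>i. i \<in> I - {s} \<Longrightarrow> d i = a i \<otimes>\<^bsub>A\<^esub> inv\<^bsub>A\<^esub> (a s [^]\<^bsub>A\<^esub> \<epsilon> i)"
    and H: "subgroup H A" and \<phi>: "circle_character A H \<phi>" and dH: "d ` (I - {s}) \<subseteq> H"
    and near: "\<And>i. i \<in> I - {s} \<Longrightarrow>
      circle_norm (\<phi> (d i) - (if \<epsilon> i = 0 then 1/2 else 0)) \<le> e"
    and e: "0 \<le> e" "e < 1/2"
  shows "circular_chromatic_number (Cay (Dih A) I c) \<le> ereal (1 / (1/2 - e))"
proof -
  interpret comm_group A by fact
  have ac: "a i \<in> carrier A" and \<epsilon>: "\<epsilon> i \<in> {0, 1}" if "i \<in> I" for i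
    using cc c[OF that] that unfolding carrier_Dih by force+
  define b where "b = a s"
  have b: "b \<in> carrier A" using ac s by (simp add: b_def)
  obtain \<Phi> where \<Phi>: "\<And>h x. h \<in> H \<Longrightarrow> x \<in> carrier A \<Longrightarrow> \<Phi> (h \<otimes>\<^bsub>A\<^esub> x) - (\<phi> h + \<Phi> x) \<in> \<int>"
    using circle_character_spread_over_cosets[OF H \<phi>] by blast
  define f where "f u = (case u of (x, \<delta>) \<Rightarrow> if \<delta> = 0 then \<Phi> x else \<Phi> (x \<otimes>\<^bsub>A\<^esub> inv\<^bsub>A\<^esub> b) + 1/2)"
    for u :: "'a \<times> nat"
  show ?thesis
  proof (rule group.circular_chromatic_number_Cay_le[OF group_Dih, where f = f])
    show "comm_group A" by fact
    show "c ` I \<subseteq> carrier (Dih A)" by (rule cc)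
    show "1 \<le> 1 / (1/2 - e)" using e by (simp add: field_simps)
  next
    fix u i
    assume u: "u \<in> carrier (Dih A)" and i: "i \<in> I"
    obtain x \<delta> where x: "u = (x, \<delta>)" "x \<in> carrier A" and \<delta>: "\<delta> = 0 \<or> \<delta> = 1"
      using u by (auto simp: carrier_Dih)
    have ci: "c i = (a i, \<epsilon> i)" "a i \<in> carrier A" "\<epsilon> i \<in> {0, 1}"
      using c ac \<epsilon> i by auto
    \<comment> \<open>The index \<open>s\<close> is treated like the others, with \<open>a s - a s\<close> as its difference.\<close>
    define h where "h = (if i = s then \<one>\<^bsub>A\<^esub> else d i)"
    define y where "y = \<phi> h - (if \<epsilon> i = 0 then 1/2 else 0)"
    have h: "h \<in> H" "h \<in> carrier A"
      using dH i subgroup.one_closed[OF H] subgroup.mem_carrier[OF H] by (auto simp: h_def)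
    have h_eq: "a i = (if \<epsilon> i = 0 then h else h \<otimes>\<^bsub>A\<^esub> b)"
      using d[of i] ac[of i] \<epsilon>[of i] i s b by (auto simp: h_def b_def m_assoc)
    have y: "circle_norm y \<le> e"
    proof (cases "i = s")
      case True
      then have "y - 0 \<in> \<int>"
        using circle_character_one[OF H \<phi>] s by (simp add: y_def h_def)
      then have "circle_norm y = circle_norm 0" by (rule circle_norm_cong)
      then show ?thesis using e by (simp add: circle_norm_def)
    next
      case False
      then show ?thesis using near[of i] i by (simp add: y_def h_def)
    qed
    \<comment> \<open>The edge adds \<open>h\<close> to a rotation but subtracts it from a reflection, which inverts what is
      multiplied on its right; hence the two signs.\<close>
    have "f (u \<otimes>\<^bsub>Dih A\<^esub> c i) - f u - (y + 1/2) \<in> \<int> \<or> f u - f (u \<otimes>\<^bsub>Dih A\<^esub> c i) - (y + 1/2) \<in> \<int>"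
    proof (cases "\<delta> = 0")
      case True
      define w where "w = x \<otimes>\<^bsub>A\<^esub> a i \<otimes>\<^bsub>A\<^esub> inv\<^bsub>A\<^esub> (if \<epsilon> i = 0 then \<one>\<^bsub>A\<^esub> else b)"
      have "x \<otimes>\<^bsub>A\<^esub> a i = h \<otimes>\<^bsub>A\<^esub> x \<otimes>\<^bsub>A\<^esub> (if \<epsilon> i = 0 then \<one>\<^bsub>A\<^esub> else b)"
        using h b x by (simp add: h_eq m_ac)
      then have "w = h \<otimes>\<^bsub>A\<^esub> x"
        using h b x by (simp add: w_def m_assoc)
      then have "\<Phi> w - (\<phi> h + \<Phi> x) \<in> \<int>"
        using \<Phi>[OF h(1) x(2)] by simp
      moreover have "f (u \<otimes>\<^bsub>Dih A\<^esub> c i) = \<Phi> w + (if \<epsilon> i = 0 then 0 else 1/2)"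
        using ci x True by (auto simp: f_def w_def Dih_mult_rotation)
      moreover have "f u = \<Phi> x"
        using x True by (simp add: f_def)
      ultimately have "f (u \<otimes>\<^bsub>Dih A\<^esub> c i) - f u - (y + 1/2) \<in> \<int>"
        by (auto simp: y_def algebra_simps)
      then show ?thesis ..
    next
      case False
      then have 1: "\<delta> = 1" using \<delta> by simp
      define w where "w = x \<otimes>\<^bsub>A\<^esub> inv\<^bsub>A\<^esub> (a i) \<otimes>\<^bsub>A\<^esub> inv\<^bsub>A\<^esub> (if \<epsilon> i = 0 then b else \<one>\<^bsub>A\<^esub>)"
      have w: "w \<in> carrier A"
        using x ci b by (simp add: w_def)
      have "w = inv\<^bsub>A\<^esub> h \<otimes>\<^bsub>A\<^esub> (x \<otimes>\<^bsub>A\<^esub> inv\<^bsub>A\<^esub> b)"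
        using h b x ci by (simp add: w_def h_eq inv_mult m_ac)
      then have "h \<otimes>\<^bsub>A\<^esub> w = x \<otimes>\<^bsub>A\<^esub> inv\<^bsub>A\<^esub> b"
        using h b x by (simp flip: m_assoc)
      then have "\<Phi> (x \<otimes>\<^bsub>A\<^esub> inv\<^bsub>A\<^esub> b) - (\<phi> h + \<Phi> w) \<in> \<int>"
        using \<Phi>[OF h(1) w] by simp
      moreover have "f (u \<otimes>\<^bsub>Dih A\<^esub> c i) = \<Phi> w + (if \<epsilon> i = 0 then 1/2 else 0)"
        using ci x 1 by (auto simp: f_def w_def Dih_mult_reflection[unfolded One_nat_def])
      moreover have "f u = \<Phi> (x \<otimes>\<^bsub>A\<^esub> inv\<^bsub>A\<^esub> b) + 1/2"
        using x 1 by (simp add: f_def)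
      ultimately have "f u - f (u \<otimes>\<^bsub>Dih A\<^esub> c i) - (y + 1/2) \<in> \<int>"
        by (auto simp: y_def algebra_simps)
      then show ?thesis ..
    qed
    then have "1/2 - circle_norm y \<le> circle_norm (f u - f (u \<otimes>\<^bsub>Dih A\<^esub> c i))"
      using circle_norm_antipodal_ge circle_norm_minus[of "f u - f (u \<otimes>\<^bsub>Dih A\<^esub> c i)"] by fastforce
    then show "1 / (1 / (1/2 - e)) \<le> circle_norm (f u - f (u \<otimes>\<^bsub>Dih A\<^esub> c i))"
      using y by simp
  qed
qed

section \<open>The bound\<close>

theorem theorem3p3:
  fixes A :: "('a, 'b) monoid_scheme"
    and m s :: nat
    and c :: "nat \<Rightarrow> 'a \<times> nat"
    and a d :: "nat \<Rightarrow> 'a"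
    and \<epsilon> :: "nat \<Rightarrow> nat"
    and r :: enat
  assumes "comm_group A"
    and "semiminimal_family (Dih A) {1..m} c"
    and "\<And>i. i \<in> {1..m} \<Longrightarrow> c i = (a i, \<epsilon> i)"
    and "\<exists>i\<in>{1..m}. \<epsilon> i = 1"
    and "s = (LEAST i. i \<in> {1..m} \<and> \<epsilon> i = 1)"
    and "\<And>i. i \<in> {1..m} - {s} \<Longrightarrow> d i = a i \<otimes>\<^bsub>A\<^esub> inv\<^bsub>A\<^esub> (a s [^]\<^bsub>A\<^esub> \<epsilon> i)"
    and "r = family_order A ({1..m} - {s}) d"
  shows "circular_chromatic_number (Cay (Dih A) {1..m} c) \<le>
    (case r of \<infinity> \<Rightarrow> 2 | enat n \<Rightarrow> ereal (2 * real n / (real n - 1)))"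
proof -
  interpret comm_group A by fact
  define I where "I = {1..m} - {s}"
  have "s \<in> {1..m} \<and> \<epsilon> s = 1"
    unfolding assms(5) using assms(4) by (rule bexE) (rule LeastI, blast)
  then have s: "s \<in> {1..m}" "\<epsilon> s = 1" by auto
  have first: "s \<le> i" if "i \<in> {1..m}" "\<epsilon> i = 1" for i
    unfolding assms(5) using that by (intro Least_le) auto
  have cc: "c ` {1..m} \<subseteq> carrier (Dih A)"
    using assms(2) by (simp add: semiminimal_family_def)
  have ac: "a i \<in> carrier A" if "i \<in> {1..m}" for i
    using cc assms(3)[OF that] that unfolding carrier_Dih by force
  have dc: "d ` I \<subseteq> carrier A"
    using assms(6) ac s unfolding I_def by auto
  define H where "H = generate A (d ` I)"
  have H: "subgroup H A"
    unfolding H_def using dc by (rule generate_is_subgroup)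
  have dH: "d ` I \<subseteq> H"
    unfolding H_def by (auto intro: generate.incl)
  have r_le: "r \<le> relative_order A I d i" if "i \<in> I" for i
    using that unfolding assms(7) family_order_def I_def by (rule INF_lower)
  have r2: "2 \<le> r"
    unfolding assms(7) family_order_def
    using two_le_relative_order_differences[OF assms(2,3) s first assms(6)]
    by (intro INF_greatest)
  obtain \<phi> where \<phi>: "circle_character A H \<phi>"
    and near: "\<And>i n. i \<in> I \<Longrightarrow> n > 0 \<Longrightarrow> enat n \<le> relative_order A I d i \<Longrightarrow>
           circle_norm (\<phi> (d i) - (if \<epsilon> i = 0 then 1/2 else 0)) \<le> 1 / (2 * real n)"
    unfolding H_def
    using circle_character_near_targets[OF _ dc, of "\<lambda>i. if \<epsilon> i = 0 then 1/2 else 0"]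
    unfolding I_def by blast
  have bound: "circular_chromatic_number (Cay (Dih A) {1..m} c) \<le> ereal (1 / (1/2 - e))"
    if "\<And>i. i \<in> I \<Longrightarrow> circle_norm (\<phi> (d i) - (if \<epsilon> i = 0 then 1/2 else 0)) \<le> e"
      "0 \<le> e" "e < 1/2" for e
    using that
    by (intro circular_chromatic_number_Cay_Dih_le[OF assms(1) cc assms(3) s assms(6) H \<phi>])
      (use dH in \<open>auto simp: I_def\<close>)
  show ?thesis
  proof (cases r)
    case (enat n)
    then have n: "2 \<le> n" using r2 by (simp add: numeral_eq_enat)
    have "circular_chromatic_number (Cay (Dih A) {1..m} c) \<le> ereal (1 / (1/2 - 1 / (2 * real n)))"
      using near[of _ n] r_le n by (intro bound) (auto simp: enat)
    also have "1 / (1/2 - 1 / (2 * real n)) = 2 * real n / (real n - 1)"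
      using n by (simp add: field_simps)
    finally show ?thesis by (simp add: enat)
  next
    case infinity
    have "circle_norm (\<phi> (d i) - (if \<epsilon> i = 0 then 1/2 else 0)) \<le> 0" if "i \<in> I" for i
    proof (rule field_le_epsilon)
      fix e :: real
      assume "0 < e"
      then obtain n where n: "n > 0" "inverse (real n) < e"
        using ex_inverse_of_nat_less by blast
      have "circle_norm (\<phi> (d i) - (if \<epsilon> i = 0 then 1/2 else 0)) \<le> 1 / (2 * real n)"
        using near[OF that n(1)] r_le[OF that] infinity by simp
      also have "\<dots> \<le> inverse (real n)"
        using n by (simp add: field_simps)
      finally show "circle_norm (\<phi> (d i) - (if \<epsilon> i = 0 then 1/2 else 0)) \<le> 0 + e"
        using n by simp
    qed
    then show ?thesis
      using bound[of 0] infinity by simp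
  qed
qed

end
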